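(* Let $(P,\preceq)$ be a locally finite lattice, $f:P\to\mathbb{C}$, and let $S=\{x_1,\dots,x_n\}\subseteq P$ be join-closed (i.e. $x\vee y\in S$ for all $x,y\in S$), indexed so that $x_i\preceq x_j\Rightarrow i\le j$. Then $$\det[S]_f=\prod_{v=1}^n\Psi_{S,f}(x_v)=\prod_{v=1}^n\sum_{x_t\in S,\ x_v\preceq x_t}f(x_t)\mu_S(x_v,x_t)=\prod_{v=1}^n\ \sum_{\substack{z\in P_S,\ x_v\preceq z\\ x_t\not\preceq z\ \text{for all } t>v}}\ \sum_{z\preceq w\preceq \vee S}f(w)\mu_{P_S}(z,w).$$
   Context: $[S]_f$ is the $n\times n$ matrix with $(i,j)$ entry $f(x_i\vee x_j)$. $\Psi_{S,f}$ is the function on $S$ defined recursively by $\Psi_{S,f}(x_k)=f(x_k)-\sum_{x_v\in S,\ x_k\prec x_v}\Psi_{S,f}(x_v)$. $\mu_S$ is the Möbius function of the finite poset $(S,\preceq)$. $\vee S=x_1\vee\cdots\vee x_n$, $P_S=\{y\in P: y\preceq\vee S \text{ and } x_i\preceq y \text{ for some } x_i\in S\}$, and $\mu_{P_S}$ is the Möbius function of the poset $(P_S,\preceq)$. *)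

theory Defs
  imports Complex_Main "Jordan_Normal_Form.Determinant"
begin

definition locally_finite :: "'a::order itself \<Rightarrow> bool" where
  "locally_finite _ \<longleftrightarrow> (\<forall>a b :: 'a. finite {a..b})"

definition join_closed :: "'a::semilattice_sup set \<Rightarrow> bool" where
  "join_closed S \<longleftrightarrow> (\<forall>x\<in>S. \<forall>y\<in>S. sup x y \<in> S)"

definition join_matrix :: "nat \<Rightarrow> (nat \<Rightarrow> 'a::semilattice_sup) \<Rightarrow> ('a \<Rightarrow> complex) \<Rightarrow> complex mat" where
  "join_matrix n x f = mat n n (\<lambda>(i, j). f (sup (x i) (x j)))"

text \<open>The guard \<open>finite S\<close> only serves to make the recursion terminate; the value for
  infinite \<open>S\<close> is a dummy.\<close>

function Psi :: "'a::order set \<Rightarrow> ('a \<Rightarrow> complex) \<Rightarrow> 'a \<Rightarrow> complex" where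
  "Psi S f x = (if finite S then f x - (\<Sum>v | v \<in> S \<and> x < v. Psi S f v) else 0)"
  by pat_completeness auto

termination
proof (relation "measure (\<lambda>(S, f, x). card {v \<in> S. x < v})")
  fix S :: "'a set" and f :: "'a \<Rightarrow> complex" and x v :: 'a
  assume "finite S" and v: "v \<in> {v. v \<in> S \<and> x < v}"
  then have "card {u \<in> S. v < u} < card {u \<in> S. x < u}"
    by (intro psubset_card_mono) (auto dest: less_trans)
  then show "((S, f, v), S, f, x) \<in> measure (\<lambda>(S, f, x). card {v \<in> S. x < v})"
    by simp
qed simp

declare Psi.simps [simp del]

text \<open>The Moebius function of the finite subposet \<open>A\<close> of the ambient order, extended by \<open>0\<close>
  outside \<open>A \<times> A\<close>. Again \<open>finite A\<close> is the termination guard.\<close>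

function mobius :: "'a::order set \<Rightarrow> 'a \<Rightarrow> 'a \<Rightarrow> int" where
  "mobius A x y =
    (if finite A \<and> x \<in> A \<and> y \<in> A \<and> x \<le> y
     then if x = y then 1 else - (\<Sum>z | z \<in> A \<and> x \<le> z \<and> z < y. mobius A x z)
     else 0)"
  by pat_completeness auto

termination
proof (relation "measure (\<lambda>(A, x, y). card {z \<in> A. z < y})")
  fix A :: "'a set" and x y z :: 'a
  assume "finite A \<and> x \<in> A \<and> y \<in> A \<and> x \<le> y" and "z \<in> {z. z \<in> A \<and> x \<le> z \<and> z < y}"
  then have "card {u \<in> A. u < z} < card {u \<in> A. u < y}"
    by (intro psubset_card_mono) (auto dest: less_trans)
  then show "((A, x, z), A, x, y) \<in> measure (\<lambda>(A, x, y). card {z \<in> A. z < y})"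
    by simp
qed simp

declare mobius.simps [simp del]

definition join_hull :: "'a::lattice set \<Rightarrow> 'a set" where
  "join_hull S = {y. y \<le> Sup_fin S \<and> (\<exists>x\<in>S. x \<le> y)}"

end

theory Submission
  imports Defs
begin

text \<open>
  Moebius inversion shows that \<open>\<Psi>\<close> is the unique function on \<open>S\<close> whose sums over up-sets
  return \<open>f\<close>. Hence \<open>f(x\<^sub>i \<squnion> x\<^sub>j) = \<Sum>\<^sub>k [x\<^sub>i \<le> x\<^sub>k] [x\<^sub>j \<le> x\<^sub>k] \<Psi>(x\<^sub>k)\<close>, which factors the join
  matrix into an upper unitriangular and a lower triangular matrix with diagonal \<open>\<Psi>(x\<^sub>k)\<close>.
  For the last expression, join-closedness gives every \<open>z\<close> in the hull a greatest element of
  \<open>S\<close> below it, namely the one of largest index. Grouping the hull by these elements turns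
  \<open>\<Psi>\<close> of the hull into a function on \<open>S\<close> with the same up-set sums as \<open>\<Psi>\<close> of \<open>S\<close>.
\<close>

lemma sum_mobius_interval:
  assumes "finite A" "x \<in> A" "y \<in> A"
  shows "(\<Sum>z | z \<in> A \<and> x \<le> z \<and> z \<le> y. mobius A x z) = (if x = y then 1 else 0)"
proof (cases "x \<le> y")
  case True
  show ?thesis
  proof (cases "x = y")
    case True
    then have "{z. z \<in> A \<and> x \<le> z \<and> z \<le> y} = {x}"
      using assms by auto
    then show ?thesis
      using True assms by (simp add: mobius.simps)
  next
    case False
    have "{z. z \<in> A \<and> x \<le> z \<and> z \<le> y} = insert y {z. z \<in> A \<and> x \<le> z \<and> z < y}"
      using assms \<open>x \<le> y\<close> by auto
    then show ?thesis
      using False assms \<open>x \<le> y\<close> by (simp add: mobius.simps[of A x y])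
  qed
next
  case False
  then have "{z. z \<in> A \<and> x \<le> z \<and> z \<le> y} = {}"
    by (auto dest: order_trans)
  with False show ?thesis
    by (simp only: sum.empty) auto
qed

text \<open>Substituting for \<open>f y\<close> and exchanging the sums leaves, for each
  \<open>v\<close>, a Moebius sum over the interval from \<open>x\<close> to \<open>v\<close>, which
  is 1 for \<open>v = x\<close> and 0 otherwise. As \<open>g\<close> is arbitrary, a function on
  \<open>A\<close> is determined by its up-set sums; this uniqueness is needed below for a
  \<open>g\<close> other than \<open>Psi\<close>.\<close>

lemma mobius_inversion_upper:
  fixes f g :: "'a::order \<Rightarrow> 'b::comm_ring_1"
  assumes "finite A" "x \<in> A"
    and f: "\<And>y. y \<in> A \<Longrightarrow> f y = (\<Sum>v | v \<in> A \<and> y \<le> v. g v)"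
  shows "g x = (\<Sum>y | y \<in> A \<and> x \<le> y. f y * of_int (mobius A x y))"
proof -
  have "(\<Sum>y | y \<in> A \<and> x \<le> y. f y * of_int (mobius A x y))
      = (\<Sum>y | y \<in> A \<and> x \<le> y. \<Sum>v | v \<in> A \<and> y \<le> v. g v * of_int (mobius A x y))"
    by (intro sum.cong) (auto simp: f sum_distrib_right)
  also have "\<dots> = (\<Sum>v\<in>A. \<Sum>y | y \<in> A \<and> x \<le> y \<and> y \<le> v. g v * of_int (mobius A x y))"
    using \<open>finite A\<close> by (subst sum.swap_restrict[symmetric, of A "{y \<in> A. x \<le> y}"
        "\<lambda>v y. g v * of_int (mobius A x y)" "\<lambda>v y. y \<le> v"]) (auto simp: conj_assoc)
  also have "\<dots> = (\<Sum>v\<in>A. if x = v then g v else 0)"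
  proof (intro sum.cong refl)
    fix v assume "v \<in> A"
    have "(\<Sum>y | y \<in> A \<and> x \<le> y \<and> y \<le> v. g v * of_int (mobius A x y))
        = g v * of_int (\<Sum>y | y \<in> A \<and> x \<le> y \<and> y \<le> v. mobius A x y)"
      by (simp add: sum_distrib_left)
    then show "(\<Sum>y | y \<in> A \<and> x \<le> y \<and> y \<le> v. g v * of_int (mobius A x y))
        = (if x = v then g v else 0)"
      using sum_mobius_interval[OF \<open>finite A\<close> \<open>x \<in> A\<close> \<open>v \<in> A\<close>] by simp
  qed
  also have "\<dots> = g x"
    using assms(1,2) by simp
  finally show ?thesis by simp
qed

lemma sum_Psi_upper:
  assumes "finite S" "x \<in> S"
  shows "f x = (\<Sum>v | v \<in> S \<and> x \<le> v. Psi S f v)"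
proof -
  have "{v. v \<in> S \<and> x \<le> v} = insert x {v. v \<in> S \<and> x < v}"
    using assms by auto
  then show ?thesis
    using assms by (simp add: Psi.simps[of S f x])
qed

lemma Psi_eq_sum_mobius:
  assumes "finite S" "x \<in> S"
  shows "Psi S f x = (\<Sum>y | y \<in> S \<and> x \<le> y. f y * of_int (mobius S x y))"
  using mobius_inversion_upper[OF assms] sum_Psi_upper[OF assms(1)] by blast

lemma det_join_matrix:
  fixes f :: "'a::lattice \<Rightarrow> complex"
  assumes inj: "inj_on x {..<n}" and S: "S = x ` {..<n}" and "join_closed S"
    and order: "\<And>i j. i < n \<Longrightarrow> j < n \<Longrightarrow> x i \<le> x j \<Longrightarrow> i \<le> j"
  shows "det (join_matrix n x f) = (\<Prod>v<n. Psi S f (x v))"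
proof -
  \<comment> \<open>\<open>E\<close> is the zeta matrix of \<open>S\<close>, and \<open>L\<close> is
    its transpose with row \<open>k\<close> scaled by \<open>Psi S f (x k)\<close>.\<close>
  define E :: "complex mat" where "E = mat n n (\<lambda>(i, k). if x i \<le> x k then 1 else 0)"
  define L where "L = mat n n (\<lambda>(k, j). if x j \<le> x k then Psi S f (x k) else 0)"
  have carrier: "E \<in> carrier_mat n n" "L \<in> carrier_mat n n"
    by (simp_all add: E_def L_def)
  have "join_matrix n x f = E * L"
  proof (rule eq_matI)
    fix i j assume "i < dim_row (E * L)" "j < dim_col (E * L)"
    then have ij: "i < n" "j < n"
      by (simp_all add: E_def L_def)
    \<comment> \<open>Up-set sums of \<open>Psi\<close> return \<open>f\<close> at points of
      \<open>S\<close>, and join-closedness puts the join among them.\<close>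
    then have "sup (x i) (x j) \<in> S"
      using \<open>join_closed S\<close> by (auto simp: S join_closed_def)
    then have "f (sup (x i) (x j)) = (\<Sum>v | v \<in> S \<and> sup (x i) (x j) \<le> v. Psi S f v)"
      by (intro sum_Psi_upper) (simp add: S)
    also have "\<dots> = (\<Sum>v\<in>S. if sup (x i) (x j) \<le> v then Psi S f v else 0)"
      by (simp add: sum.If_cases S Int_def)
    also have "\<dots> = (\<Sum>k<n. if sup (x i) (x j) \<le> x k then Psi S f (x k) else 0)"
      unfolding S by (simp add: sum.reindex[OF inj])
    \<comment> \<open>The join is below \<open>x k\<close> exactly when both \<open>x i\<close> and
      \<open>x j\<close> are, so the indicator is a product of two indicators.\<close>
    also have "\<dots> = (E * L) $$ (i, j)"
      using ij by (auto simp: E_def L_def scalar_prod_def atLeast0LessThan intro!: sum.cong)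
    finally show "join_matrix n x f $$ (i, j) = (E * L) $$ (i, j)"
      using ij by (simp add: join_matrix_def)
  qed (simp_all add: join_matrix_def E_def L_def)
  moreover have "det E = 1"
  proof -
    \<comment> \<open>The indexing is a linear extension of the order: a nonzero entry with
      \<open>j < i\<close> would mean \<open>x i\<close> \<le> \<open>x j\<close> and hence
      \<open>i\<close> \<le> \<open>j\<close>.\<close>
    have "E $$ (i, j) = 0" if "j < i" "i < n" for i j
      using that order[of i j] by (auto simp: E_def)
    then have "upper_triangular E"
      by (simp add: upper_triangular_def E_def)
    then have "det E = prod_list (diag_mat E)"
      using carrier(1) by (rule det_upper_triangular)
    also have "\<dots> = 1"
      by (simp add: prod_list_diag_prod E_def)
    finally show ?thesis .
  qed
  moreover have "det L = (\<Prod>v<n. Psi S f (x v))"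
  proof -
    have "L $$ (i, j) = 0" if "i < j" "j < n" for i j
      using that order[of j i] by (auto simp: L_def)
    then have "det L = prod_list (diag_mat L)"
      using carrier(2) by (intro det_lower_triangular) auto
    also have "\<dots> = (\<Prod>v<n. Psi S f (x v))"
      by (simp add: prod_list_diag_prod L_def atLeast0LessThan)
    finally show ?thesis .
  qed
  ultimately show ?thesis
    using det_mult[OF carrier] by simp
qed

lemma finite_join_hull:
  fixes S :: "'a::lattice set"
  assumes "locally_finite TYPE('a)" "finite S"
  shows "finite (join_hull S)"
proof -
  have "join_hull S = (\<Union>x\<in>S. {x..Sup_fin S})"
    by (auto simp: join_hull_def)
  then show ?thesis
    using assms by (simp add: locally_finite_def)
qed

lemma join_closed_Sup_fin_mem:
  assumes "finite A" "A \<noteq> {}" "A \<subseteq> T" "join_closed T"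
  shows "Sup_fin A \<in> T"
  using assms by (induction A rule: finite_ne_induct) (auto simp: join_closed_def)

lemma Psi_eq_sum_Psi_join_hull:
  fixes S :: "'a::lattice set"
  assumes lf: "locally_finite TYPE('a)" and "finite S" "join_closed S" "x \<in> S"
  shows "Psi S f x = (\<Sum>z | z \<in> join_hull S \<and> x \<le> z \<and> (\<forall>s\<in>S. s \<le> z \<longrightarrow> s \<le> x).
    Psi (join_hull S) f z)"
proof -
  let ?P = "join_hull S"
  \<comment> \<open>These are the fibres of the map that sends \<open>z\<close> to the greatest
    element of \<open>S\<close> below \<open>z\<close>.\<close>
  let ?C = "\<lambda>u. {z. z \<in> ?P \<and> u \<le> z \<and> (\<forall>s\<in>S. s \<le> z \<longrightarrow> s \<le> u)}"
  have fin: "finite ?P"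
    using lf \<open>finite S\<close> by (rule finite_join_hull)
  have "f y = (\<Sum>u | u \<in> S \<and> y \<le> u. \<Sum>z\<in>?C u. Psi ?P f z)" if "y \<in> S" for y
  proof -
    have cover: "{z. z \<in> ?P \<and> y \<le> z} = (\<Union>u\<in>{u. u \<in> S \<and> y \<le> u}. ?C u)"
    proof (intro equalityI subsetI)
      fix z assume z: "z \<in> {z. z \<in> ?P \<and> y \<le> z}"
      \<comment> \<open>The join of all elements of \<open>S\<close> below \<open>z\<close> stays in
        \<open>S\<close> and below \<open>z\<close>. Since \<open>y\<close> is one of them, the join
        exists and lies above \<open>y\<close>, so it is the required \<open>u\<close>.\<close>
      let ?T = "{s \<in> S. s \<le> z}"
      have "join_closed ?T"
        using \<open>join_closed S\<close> by (simp add: join_closed_def)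
      then have "Sup_fin ?T \<in> ?T"
        using \<open>finite S\<close> z \<open>y \<in> S\<close> by (intro join_closed_Sup_fin_mem) auto
      moreover have "s \<le> Sup_fin ?T" if "s \<in> ?T" for s
        using that \<open>finite S\<close> by (intro Sup_fin.coboundedI) auto
      ultimately show "z \<in> (\<Union>u\<in>{u. u \<in> S \<and> y \<le> u}. ?C u)"
        using z \<open>y \<in> S\<close> by blast
    qed (auto dest: order_trans)
    have "y \<in> ?P"
      using \<open>y \<in> S\<close> \<open>finite S\<close> by (auto simp: join_hull_def intro: Sup_fin.coboundedI)
    then have "f y = (\<Sum>z | z \<in> ?P \<and> y \<le> z. Psi ?P f z)"
      using fin by (intro sum_Psi_upper)
    \<comment> \<open>The fibres are disjoint, because two greatest elements of the same set agree
      by antisymmetry.\<close>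
    also have "\<dots> = (\<Sum>u | u \<in> S \<and> y \<le> u. \<Sum>z\<in>?C u. Psi ?P f z)"
      unfolding cover using \<open>finite S\<close> fin by (intro sum.UNION_disjoint) (auto intro: antisym)
    finally show ?thesis .
  qed
  \<comment> \<open>The fibre sums take the role of \<open>g\<close> in the inversion, which yields
    the same Moebius sum as for \<open>Psi S f x\<close>.\<close>
  then have "(\<Sum>z\<in>?C x. Psi ?P f z) = (\<Sum>y | y \<in> S \<and> x \<le> y. f y * of_int (mobius S x y))"
    using \<open>finite S\<close> \<open>x \<in> S\<close> by (intro mobius_inversion_upper)
  then show ?thesis
    using \<open>finite S\<close> \<open>x \<in> S\<close> by (simp add: Psi_eq_sum_mobius)
qed

text \<open>This passes from the condition on indices in the theorem to the order-theoretic
  description of the fibres. For \<open>s\<close> in \<open>S\<close> below \<open>z\<close>, the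
  join of \<open>s\<close> and \<open>x v\<close> is some \<open>x t\<close> below \<open>z\<close>
  with \<open>v\<close> \<le> \<open>t\<close>; if no later index is allowed, then
  \<open>t = v\<close> and \<open>s\<close> is below \<open>x v\<close>.\<close>

lemma join_closed_index_iff:
  fixes x :: "nat \<Rightarrow> 'a::lattice"
  assumes S: "S = x ` {..<n}" and "join_closed S"
    and order: "\<And>i j. i < n \<Longrightarrow> j < n \<Longrightarrow> x i \<le> x j \<Longrightarrow> i \<le> j"
    and "v < n" "x v \<le> z"
  shows "(\<forall>t. v < t \<and> t < n \<longrightarrow> \<not> x t \<le> z) \<longleftrightarrow> (\<forall>s\<in>S. s \<le> z \<longrightarrow> s \<le> x v)"
proof
  assume none: "\<forall>t. v < t \<and> t < n \<longrightarrow> \<not> x t \<le> z"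
  show "\<forall>s\<in>S. s \<le> z \<longrightarrow> s \<le> x v"
  proof (intro ballI impI)
    fix s assume "s \<in> S" "s \<le> z"
    moreover have "x v \<in> S"
      using \<open>v < n\<close> by (simp add: S)
    ultimately have "sup s (x v) \<in> S"
      using \<open>join_closed S\<close> by (simp add: join_closed_def)
    then obtain t where t: "t < n" "sup s (x v) = x t"
      by (auto simp: S)
    then have "v \<le> t"
      using order[of v t] \<open>v < n\<close> sup.cobounded2[of "x v" s] by simp
    moreover have "x t \<le> z"
      using \<open>s \<le> z\<close> \<open>x v \<le> z\<close> by (simp flip: t(2))
    ultimately have "t = v"
      using none t(1) by (metis le_neq_implies_less)
    then show "s \<le> x v"
      using t(2) by (metis sup.cobounded1)
  qed
next
  assume "\<forall>s\<in>S. s \<le> z \<longrightarrow> s \<le> x v"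
  then have "t \<le> v" if "t < n" "x t \<le> z" for t
    using that order[of t v] \<open>v < n\<close> by (simp add: S)
  then show "\<forall>t. v < t \<and> t < n \<longrightarrow> \<not> x t \<le> z"
    by (meson not_le)
qed

theorem theorem4p2:
  fixes f :: "'a::lattice \<Rightarrow> complex" and x :: "nat \<Rightarrow> 'a" and n :: nat and S :: "'a set"
  assumes "locally_finite TYPE('a)"
    and "0 < n"
    and "inj_on x {..<n}"
    and "S = x ` {..<n}"
    and "join_closed S"
    and "\<And>i j. i < n \<Longrightarrow> j < n \<Longrightarrow> x i \<le> x j \<Longrightarrow> i \<le> j"
  shows "det (join_matrix n x f) = (\<Prod>v<n. Psi S f (x v))
    \<and> (\<Prod>v<n. Psi S f (x v))
        = (\<Prod>v<n. \<Sum>y | y \<in> S \<and> x v \<le> y. f y * of_int (mobius S (x v) y))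
    \<and> (\<Prod>v<n. \<Sum>y | y \<in> S \<and> x v \<le> y. f y * of_int (mobius S (x v) y))
        = (\<Prod>v<n. \<Sum>z | z \<in> join_hull S \<and> x v \<le> z \<and> (\<forall>t. v < t \<and> t < n \<longrightarrow> \<not> x t \<le> z).
             \<Sum>w | z \<le> w \<and> w \<le> Sup_fin S. f w * of_int (mobius (join_hull S) z w))"
proof -
  let ?P = "join_hull S"
  have fin: "finite S"
    using assms(4) by simp
  have mob: "Psi S f (x v) = (\<Sum>y | y \<in> S \<and> x v \<le> y. f y * of_int (mobius S (x v) y))"
    if "v < n" for v
    using that fin assms(4) by (intro Psi_eq_sum_mobius) auto
  have inner: "Psi ?P f z = (\<Sum>w | z \<le> w \<and> w \<le> Sup_fin S. f w * of_int (mobius ?P z w))"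
    if "z \<in> ?P" for z
  proof -
    \<comment> \<open>Whatever lies between a hull element and the join of \<open>S\<close> is
      itself in the hull, so this interval of the lattice is the up-set of \<open>z\<close> in the
      hull.\<close>
    have "{w. z \<le> w \<and> w \<le> Sup_fin S} = {w. w \<in> ?P \<and> z \<le> w}"
      using that by (auto simp: join_hull_def intro: order_trans)
    then show ?thesis
      using Psi_eq_sum_mobius[OF finite_join_hull[OF assms(1) fin] that] by simp
  qed
  have hull: "Psi S f (x v)
      = (\<Sum>z | z \<in> ?P \<and> x v \<le> z \<and> (\<forall>t. v < t \<and> t < n \<longrightarrow> \<not> x t \<le> z).
          \<Sum>w | z \<le> w \<and> w \<le> Sup_fin S. f w * of_int (mobius ?P z w))"
    if "v < n" for v
  proof -
    have "Psi S f (x v)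
        = (\<Sum>z | z \<in> ?P \<and> x v \<le> z \<and> (\<forall>s\<in>S. s \<le> z \<longrightarrow> s \<le> x v). Psi ?P f z)"
      using that assms(4) by (intro Psi_eq_sum_Psi_join_hull[OF assms(1) fin assms(5)]) auto
    also have "\<dots> = (\<Sum>z | z \<in> ?P \<and> x v \<le> z \<and> (\<forall>t. v < t \<and> t < n \<longrightarrow> \<not> x t \<le> z).
        \<Sum>w | z \<le> w \<and> w \<le> Sup_fin S. f w * of_int (mobius ?P z w))"
      using join_closed_index_iff[OF assms(4,5,6) that] inner
      by (intro sum.cong) blast+
    finally show ?thesis .
  qed
  show ?thesis
    using det_join_matrix[OF assms(3-6)] mob hull by simp
qed

end
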